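(* Let $p(z_1,z_2)=a_{10}z_1+a_{01}z_2+a_{20}z_1^2+a_{11}z_1z_2+a_{02}z_2^2$ be a complex polynomial in two variables of degree at most $2$ with $p(\boldsymbol 0)=0$, and put $p_1(z)=a_{10}+a_{01}z$, $p_2(z)=a_{20}+a_{11}z+a_{02}z^2$. If there exists a holomorphic function $q:\mathbb D^2\to\mathbb C$ with $q^{(I)}(\boldsymbol 0)=0$ for all multi-indices $I$ with $|I|\le 2$ such that $\sup_{\mathbb D^2}|p+q|\le 1$, then $|p_1(z)|^2+|p_2(z)|\le 1$ for all $z\in\mathbb D$.
   Context: $\mathbb D$ is the open unit disc in $\mathbb C$. For a multi-index $I=(i_1,i_2)$, $q^{(I)}=\partial_1^{i_1}\partial_2^{i_2}q$ and $|I|=i_1+i_2$. *)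

theory Defs
  imports "HOL-Complex_Analysis.Complex_Analysis"
begin

abbreviation unit_disc :: "complex set" (\<open>\<D>\<close>)
  where "\<D> \<equiv> ball 0 1"

text \<open>
  Holomorphy in two variables is complex (Frechet) differentiability: the real derivative exists
  at each point and is complex linear, i.e. of the form \<open>(h, k) \<mapsto> a h + b k\<close>.  As for
  \<^const>\<open>holomorphic_on\<close>, the derivative is taken within \<open>S\<close>, which matters only if \<open>S\<close> is not open.
\<close>

definition holomorphic2_on :: "(complex \<times> complex \<Rightarrow> complex) \<Rightarrow> (complex \<times> complex) set \<Rightarrow> bool"
    (infixl \<open>holomorphic2'_on\<close> 50)
  where "f holomorphic2_on S \<longleftrightarrow>
    (\<forall>z\<in>S. \<exists>a b. (f has_derivative (\<lambda>(h, k). a * h + b * k)) (at z within S))"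

definition partial1 :: "(complex \<times> complex \<Rightarrow> complex) \<Rightarrow> complex \<times> complex \<Rightarrow> complex"
  where "partial1 f = (\<lambda>(z, w). deriv (\<lambda>u. f (u, w)) z)"

definition partial2 :: "(complex \<times> complex \<Rightarrow> complex) \<Rightarrow> complex \<times> complex \<Rightarrow> complex"
  where "partial2 f = (\<lambda>(z, w). deriv (\<lambda>u. f (z, u)) w)"

definition mixed_partial ::
    "nat \<times> nat \<Rightarrow> (complex \<times> complex \<Rightarrow> complex) \<Rightarrow> complex \<times> complex \<Rightarrow> complex"
  where "mixed_partial I f = (partial1 ^^ fst I) ((partial2 ^^ snd I) f)"

end

theory Submission
  imports Defs
begin

text \<open>
  For fixed \<open>z\<close> in the disc, restrict \<open>p + q\<close> to the slice \<open>t \<mapsto> (t, t z)\<close>.  The result is bounded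
  by 1 and equals \<open>t p\<^sub>1(z) + t\<^sup>2 p\<^sub>2(z) + o(t\<^sup>2)\<close>, so by the Schwarz lemma its quotient by \<open>t\<close> is a
  self-map \<open>g\<close> of the closed disc with \<open>g(0) = p\<^sub>1(z)\<close> and \<open>g'(0) = p\<^sub>2(z)\<close>; the claim is the
  Schwarz-Pick inequality for \<open>g\<close> at 0.  The \<open>o(t\<^sup>2)\<close> estimate comes from expanding \<open>q(t, w)\<close> in
  powers of \<open>w\<close>: the Taylor coefficients are holomorphic functions of \<open>t\<close> that vanish at 0 to the
  order given by the hypothesis on the derivatives of \<open>q\<close>.
\<close>

subsection \<open>The Schwarz-Pick inequality at the origin\<close>

lemma le_of_scaled_le:
  fixes a b :: real
  assumes "\<And>s. 0 < s \<Longrightarrow> s < 1 \<Longrightarrow> s * a \<le> b"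
  shows "a \<le> b"
proof (rule tendsto_upperbound)
  show "((\<lambda>s. s * a) \<longlongrightarrow> a) (at_left 1)"
    by (auto intro!: tendsto_eq_intros)
  show "\<forall>\<^sub>F s in at_left 1. s * a \<le> b"
    using eventually_at_left_real[of 0 "1::real"] by (rule eventually_mono) (auto intro: assms)
qed simp

text \<open>\<open>Schwarz_Lemma\<close> asks for values in the open disc, so it is applied to
  \<open>s * f\<close> with \<open>0 < s < 1\<close>, and then \<open>s\<close> tends to 1.\<close>

lemma Schwarz_bound_closed_disc:
  assumes hol: "f holomorphic_on ball 0 1" and f0: "f 0 = 0"
    and le: "\<And>z. norm z < 1 \<Longrightarrow> norm (f z) \<le> 1" and z: "norm z < 1"
  shows "norm (f z) \<le> norm z"
proof (rule le_of_scaled_le)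
  fix s :: real assume s: "0 < s" "s < 1"
  have "norm (of_real s * f z) \<le> norm z"
  proof (rule Schwarz_Lemma(1)[of "\<lambda>z. of_real s * f z"])
    show "(\<lambda>z. of_real s * f z) holomorphic_on ball 0 1"
      by (intro holomorphic_intros hol)
    show "norm (of_real s * f w) < 1" if "norm w < 1" for w
      using le_less_trans[OF mult_left_le[OF le[OF that], of s], of 1] s by (simp add: norm_mult)
  qed (use f0 z in auto)
  then show "s * norm (f z) \<le> norm z"
    using s by (simp add: norm_mult)
qed

text \<open>Following \<open>g\<close> by the disc automorphism that sends \<open>g 0\<close> to 0
  gives a map \<open>h\<close> to which the Schwarz lemma applies. By the chain rule
  \<open>deriv h 0\<close> is \<open>deriv g 0\<close> divided by
  \<open>1 - norm (g 0) ^ 2\<close>.\<close>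

lemma Schwarz_Pick_at_0:
  assumes hol: "g holomorphic_on ball 0 1" and lt: "\<And>z. norm z < 1 \<Longrightarrow> norm (g z) < 1"
  shows "norm (deriv g 0) \<le> 1 - norm (g 0) ^ 2"
proof -
  define \<alpha> where "\<alpha> = g 0"
  have \<alpha>: "norm \<alpha> < 1"
    using lt[of 0] by (simp add: \<alpha>_def)
  define h where "h = Moebius_function 0 \<alpha> \<circ> g"
  have holh: "h holomorphic_on ball 0 1"
    unfolding h_def
    by (rule holomorphic_on_compose_gen[OF hol Moebius_function_holomorphic[OF \<alpha>]])
       (use lt in auto)
  have "norm (deriv h 0) \<le> 1"
  proof (rule Schwarz_Lemma(2)[OF holh])
    show "h 0 = 0"
      by (simp add: h_def \<alpha>_def Moebius_function_eq_zero)
    show "norm (h z) < 1" if "norm z < 1" for z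
      using Moebius_function_norm_lt_1[OF \<alpha> lt[OF that]] by (simp add: h_def)
    show "norm (0::complex) < 1" by simp
  qed
  moreover have "deriv h 0 = deriv g 0 / of_real (1 - norm \<alpha> ^ 2)"
  proof (rule DERIV_imp_deriv)
    have \<alpha>2: "cnj \<alpha> * \<alpha> = of_real (norm \<alpha> ^ 2)"
      by (simp only: mult.commute[of "cnj \<alpha>"] complex_norm_square[symmetric] of_real_power)
    have ne: "1 - (of_real (norm \<alpha> ^ 2) :: complex) \<noteq> 0"
    proof -
      have "norm \<alpha> ^ 2 \<noteq> 1"
        using \<alpha> power_less_one_iff[of "norm \<alpha>" 2] by simp
      then show ?thesis by (metis eq_iff_diff_eq_0 of_real_eq_1_iff)
    qed
    have dg: "(g has_field_derivative deriv g 0) (at 0)"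
      by (rule holomorphic_derivI[OF hol]) auto
    have "((\<lambda>z. (g z - \<alpha>) / (1 - cnj \<alpha> * g z)) has_field_derivative
        ((deriv g 0 - 0) * (1 - cnj \<alpha> * g 0) - (g 0 - \<alpha>) * (0 - cnj \<alpha> * deriv g 0)) /
          ((1 - cnj \<alpha> * g 0) * (1 - cnj \<alpha> * g 0))) (at 0)"
      using ne \<alpha>2 by (intro DERIV_divide DERIV_diff DERIV_const DERIV_cmult dg) (simp add: \<alpha>_def)
    \<comment> \<open>Since \<open>g 0\<close> is \<open>\<alpha>\<close>, the second product in the
      numerator vanishes and one factor \<open>1 - norm \<alpha> ^ 2\<close> cancels.\<close>
    moreover have "((deriv g 0 - 0) * (1 - cnj \<alpha> * g 0) - (g 0 - \<alpha>) * (0 - cnj \<alpha> * deriv g 0)) /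
          ((1 - cnj \<alpha> * g 0) * (1 - cnj \<alpha> * g 0)) = deriv g 0 / of_real (1 - norm \<alpha> ^ 2)"
      using ne \<alpha>2 by (simp add: \<alpha>_def)
    ultimately have "((\<lambda>z. (g z - \<alpha>) / (1 - cnj \<alpha> * g z)) has_field_derivative
        deriv g 0 / of_real (1 - norm \<alpha> ^ 2)) (at 0)"
      by simp
    then show "(h has_field_derivative deriv g 0 / of_real (1 - norm \<alpha> ^ 2)) (at 0)"
      by (simp add: h_def o_def Moebius_function_simple)
  qed
  moreover have "0 < 1 - norm \<alpha> ^ 2"
    using \<alpha> power_less_one_iff[of "norm \<alpha>" 2] by simp
  ultimately show ?thesis
    by (simp add: \<alpha>_def norm_divide divide_simps del: of_real_diff of_real_power)
qed

text \<open>Again by scaling with \<open>s < 1\<close>; the resulting inequality is quadratic in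
  \<open>s\<close>, so the limit is taken directly instead of through
  \<open>le_of_scaled_le\<close>.\<close>

lemma Schwarz_Pick_at_0_closed_disc:
  assumes hol: "g holomorphic_on ball 0 1" and le: "\<And>z. norm z < 1 \<Longrightarrow> norm (g z) \<le> 1"
  shows "norm (g 0) ^ 2 + norm (deriv g 0) \<le> 1"
proof -
  have bd: "(s * norm (g 0)) ^ 2 + s * norm (deriv g 0) \<le> 1" if s: "0 < s" "s < 1" for s :: real
  proof -
    have "norm (deriv (\<lambda>z. of_real s * g z) 0) \<le> 1 - norm (of_real s * g 0) ^ 2"
    proof (rule Schwarz_Pick_at_0)
      show "(\<lambda>z. of_real s * g z) holomorphic_on ball 0 1"
        by (intro holomorphic_intros hol)
      show "norm (of_real s * g w) < 1" if "norm w < 1" for w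
        using le_less_trans[OF mult_left_le[OF le[OF that], of s], of 1] s by (simp add: norm_mult)
    qed
    moreover have "deriv (\<lambda>z. of_real s * g z) 0 = of_real s * deriv g 0"
      by (rule deriv_cmult, rule holomorphic_on_imp_differentiable_at[OF hol]) auto
    ultimately show ?thesis
      using s by (simp add: norm_mult)
  qed
  show ?thesis
  proof (rule tendsto_upperbound)
    show "((\<lambda>s. (s * norm (g 0)) ^ 2 + s * norm (deriv g 0))
        \<longlongrightarrow> norm (g 0) ^ 2 + norm (deriv g 0)) (at_left 1)"
      by (auto intro!: tendsto_eq_intros)
    show "\<forall>\<^sub>F s in at_left 1. (s * norm (g 0)) ^ 2 + s * norm (deriv g 0) \<le> 1"
      using eventually_at_left_real[of 0 "1::real"] by (rule eventually_mono) (auto intro: bd)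
  qed simp
qed

subsection \<open>Taylor coefficients depending on a parameter\<close>

text \<open>A disc of radius \<open>R / 3\<close> about a point of \<open>cball 0 (R / 3)\<close>
  stays within norm \<open>2 * R / 3\<close>, so Cauchy's inequality bounds the derivative of order
  \<open>Suc n\<close> there. The constant depends on \<open>f\<close> only through
  \<open>M\<close>, which makes the estimate uniform over families with a common bound.\<close>

lemma Taylor_remainder_bound:
  assumes hol: "f holomorphic_on ball 0 R" and le: "\<And>z. norm z < R \<Longrightarrow> norm (f z) \<le> M"
    and w: "norm w \<le> R / 3" and R: "R > 0"
  shows "norm (f w - (\<Sum>i\<le>n. (deriv ^^ i) f 0 * w ^ i / fact i))
      \<le> fact (Suc n) * M / (R / 3) ^ Suc n / fact n * norm w ^ Suc n"
proof -
  have sub: "cball x (R / 3) \<subseteq> ball 0 R" if "x \<in> cball 0 (R / 3)" for x :: complex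
  proof
    fix y assume y: "y \<in> cball x (R / 3)"
    show "y \<in> ball 0 R"
      using norm_triangle_ineq[of x "y - x"] that y R by (simp add: dist_norm norm_minus_commute)
  qed
  have "norm ((deriv ^^ 0) f w - (\<Sum>i\<le>n. (deriv ^^ i) f 0 * (w - 0) ^ i / fact i))
      \<le> fact (Suc n) * M / (R / 3) ^ Suc n * norm (w - 0) ^ Suc n / fact n"
  proof (rule complex_Taylor[of "cball 0 (R / 3)" n "\<lambda>i. (deriv ^^ i) f"])
    show "((deriv ^^ i) f has_field_derivative (deriv ^^ Suc i) f x) (at x within cball 0 (R / 3))"
      if "x \<in> cball 0 (R / 3)" "i \<le> n" for i x
      by (rule has_field_derivative_at_within, rule has_field_derivative_higher_deriv[OF hol])
         (use that R in auto)
    show "norm ((deriv ^^ Suc n) f x) \<le> fact (Suc n) * M / (R / 3) ^ Suc n"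
      if "x \<in> cball 0 (R / 3)" for x
    proof (rule Cauchy_inequality)
      show "f holomorphic_on ball x (R / 3)"
        using sub[OF that] ball_subset_cball by (blast intro: holomorphic_on_subset[OF hol])
      show "continuous_on (cball x (R / 3)) f"
        using sub[OF that] hol holomorphic_on_imp_continuous_on continuous_on_subset by blast
      show "norm (f y) \<le> M" if y: "norm (x - y) = R / 3" for y
      proof (rule le)
        have "y \<in> cball x (R / 3)" using y by (simp add: dist_norm)
        then show "norm y < R" using sub[OF \<open>x \<in> _\<close>] by auto
      qed
    qed (use R in simp)
  qed (use w R in auto)
  then show ?thesis by simp
qed

text \<open>The Taylor polynomial of degree \<open>n\<close> is zero, so \<open>f\<close> equals its
  own remainder, which is of order \<open>norm z ^ Suc n\<close>.\<close>

lemma tendsto_divide_power_of_higher_derivs_eq_0: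
  assumes hol: "f holomorphic_on ball 0 R" and R: "R > 0"
    and zero: "\<And>i. i \<le> n \<Longrightarrow> (deriv ^^ i) f 0 = 0"
  shows "((\<lambda>z. f z / z ^ n) \<longlongrightarrow> 0) (at 0)"
proof -
  \<comment> \<open>\<open>f\<close> may be unbounded on \<open>ball 0 R\<close>; compactness
    supplies a bound on the disc of radius \<open>R / 2\<close>, which then takes the place of
    \<open>R\<close> in the Taylor estimate.\<close>
  have "compact (f ` cball 0 (R / 2))"
    by (rule compact_continuous_image)
       (use R hol in \<open>auto intro!: continuous_on_subset[OF holomorphic_on_imp_continuous_on]\<close>)
  then obtain M where M: "\<And>z. norm z \<le> R / 2 \<Longrightarrow> norm (f z) \<le> M"
    by (fastforce dest: compact_imp_bounded simp: bounded_iff)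
  define C where "C = fact (Suc n) * M / (R / 2 / 3) ^ Suc n / fact n"
  have bd: "norm (f z) \<le> C * norm z ^ Suc n" if "norm z \<le> R / 2 / 3" for z
  proof -
    have "norm (f z - (\<Sum>i\<le>n. (deriv ^^ i) f 0 * z ^ i / fact i)) \<le> C * norm z ^ Suc n"
      unfolding C_def
      by (rule Taylor_remainder_bound)
         (use that M R hol in \<open>auto intro: holomorphic_on_subset\<close>)
    then show ?thesis using zero by simp
  qed
  show ?thesis
  proof (rule Lim_null_comparison)
    show "\<forall>\<^sub>F z in at 0. norm (f z / z ^ n) \<le> C * norm z"
      unfolding eventually_at
    proof (intro exI[of _ "R / 2 / 3"] conjI ballI impI)
      fix z :: complex assume "z \<noteq> 0 \<and> dist z 0 < R / 2 / 3"
      then show "norm (f z / z ^ n) \<le> C * norm z"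
        using bd[of z] by (simp add: norm_divide norm_power field_simps)
    qed (use R in simp)
    show "((\<lambda>z. C * norm z) \<longlongrightarrow> 0) (at (0::complex))"
      by (auto intro!: tendsto_eq_intros)
  qed
qed

text \<open>Strong induction on \<open>k\<close>: once the lower coefficients are holomorphic in
  \<open>z\<close>, the next one is a locally uniform limit of holomorphic functions built from
  \<open>F z\<close> at points tending to 0.\<close>

lemma holomorphic_on_Taylor_coeff:
  assumes S: "open S" and R: "R > 0"
    and hol1: "\<And>w. norm w < R \<Longrightarrow> (\<lambda>z. F z w) holomorphic_on S"
    and hol2: "\<And>z. z \<in> S \<Longrightarrow> F z holomorphic_on ball 0 R"
    and le: "\<And>z w. z \<in> S \<Longrightarrow> norm w < R \<Longrightarrow> norm (F z w) \<le> M"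
  shows "(\<lambda>z. (deriv ^^ k) (F z) 0) holomorphic_on S"
proof (induction k rule: less_induct)
  case (less k)
  \<comment> \<open>Sample points tending to 0, positive and inside the radius \<open>R / 3\<close>
    where \<open>Taylor_remainder_bound\<close> holds.\<close>
  define w where "w n = R / 3 / of_nat (Suc n)" for n
  have w: "w n > 0" "w n \<le> R / 3" for n
    using R by (simp_all add: w_def field_simps)
  have w_lim: "w \<longlonglongrightarrow> 0"
    unfolding w_def by (rule LIMSEQ_Suc, rule lim_const_over_n)
  define c where "c i z = (deriv ^^ i) (F z) 0" for i z
  \<comment> \<open>The Taylor expansion at \<open>w n\<close>, cut off after order
    \<open>k\<close>, solved for the coefficient \<open>c k z\<close>. The error is the remainder
    times \<open>fact k / w n ^ k\<close>, hence at most \<open>C * w n\<close> with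
    \<open>C\<close> independent of \<open>z\<close>.\<close>
  define D where "D n z = (F z (of_real (w n)) - (\<Sum>i<k. c i z * of_real (w n) ^ i / fact i))
      * fact k / of_real (w n) ^ k" for n z
  define C where "C = fact (Suc k) * M / (R / 3) ^ Suc k"
  have bd: "norm (D n z - c k z) \<le> C * w n" if z: "z \<in> S" for n z
  proof -
    let ?w = "of_real (w n) :: complex"
    let ?r = "F z ?w - (\<Sum>i\<le>k. c i z * ?w ^ i / fact i)"
    have "norm ?r \<le> C / fact k * norm ?w ^ Suc k"
      unfolding C_def c_def
      by (rule Taylor_remainder_bound[OF hol2[OF z] le[OF z]]) (use w[of n] R in auto)
    moreover have "norm (D n z - c k z) = norm ?r * fact k / w n ^ k"
    proof -
      have "D n z - c k z = ?r * fact k / ?w ^ k"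
        unfolding D_def lessThan_Suc_atMost[symmetric] using w(1)[of n] by (simp add: field_simps)
      then show ?thesis
        using w(1)[of n] by (simp only: norm_mult norm_divide norm_power norm_of_real norm_fact abs_of_pos)
    qed
    ultimately have "w n ^ k * norm (D n z - c k z) \<le> w n ^ k * (C * w n)"
      using w(1)[of n] by (simp add: field_simps)
    then show ?thesis
      using w(1)[of n] by (simp add: mult_le_cancel_left_pos)
  qed
  have "c k holomorphic_on S"
  proof (rule holomorphic_uniform_sequence[OF S])
    show "D n holomorphic_on S" for n
    proof -
      have "norm (of_real (w n) :: complex) < R"
        using w[of n] R by simp
      then show ?thesis
        unfolding D_def c_def using w(1)[of n]
        by (intro holomorphic_intros hol1 less.IH) auto
    qed
    show "\<exists>d>0. cball x d \<subseteq> S \<and> uniform_limit (cball x d) D (c k) sequentially"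
      if x: "x \<in> S" for x
    proof -
      obtain d where d: "d > 0" "cball x d \<subseteq> S"
        using S x open_contains_cball by blast
      have "uniform_limit (cball x d) D (c k) sequentially"
      proof (rule uniform_limitI)
        fix e :: real assume e: "e > 0"
        have "(\<lambda>n. C * w n) \<longlonglongrightarrow> 0"
          using tendsto_mult_left[OF w_lim, of C] by simp
        then have "\<forall>\<^sub>F n in sequentially. C * w n < e"
          using e by (rule order_tendstoD)
        then show "\<forall>\<^sub>F n in sequentially. \<forall>y\<in>cball x d. dist (D n y) (c k y) < e"
        proof eventually_elim
          case (elim n)
          have "dist (D n y) (c k y) < e" if "y \<in> cball x d" for y
            using le_less_trans[OF bd elim] that d(2) by (auto simp: dist_norm)
          then show ?case ..
        qed
      qed
      with d show ?thesis by blast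
    qed
  qed
  then show ?case by (simp add: c_def[abs_def])
qed

subsection \<open>Functions of two variables on a slice\<close>

lemma funpow_partial1: "(partial1 ^^ i) f (z, w) = (deriv ^^ i) (\<lambda>u. f (u, w)) z"
  by (induction i arbitrary: z) (simp_all add: partial1_def)

lemma funpow_partial2: "(partial2 ^^ j) f (z, w) = (deriv ^^ j) (\<lambda>u. f (z, u)) w"
  by (induction j arbitrary: w) (simp_all add: partial2_def)

text \<open>The inner derivative is, up to a factorial, a Taylor coefficient in the second variable,
  so at the origin vanishing mixed partials become vanishing derivatives of that
  coefficient.\<close>

lemma mixed_partial_eq:
  "mixed_partial (i, j) f (z, w) = (deriv ^^ i) (\<lambda>u. (deriv ^^ j) (\<lambda>v. f (u, v)) w) z"
  by (simp add: mixed_partial_def funpow_partial1 funpow_partial2)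

text \<open>Chain rule; it serves both the coordinate slices and the slice
  \<open>t \<mapsto> (t, t * z)\<close>.\<close>

lemma holomorphic2_on_compose:
  assumes f: "f holomorphic2_on S" and S: "open S" and T: "open T"
    and g: "g holomorphic_on T" and h: "h holomorphic_on T"
    and sub: "\<And>t. t \<in> T \<Longrightarrow> (g t, h t) \<in> S"
  shows "(\<lambda>t. f (g t, h t)) holomorphic_on T"
  unfolding holomorphic_on_open[OF T]
proof
  fix t assume t: "t \<in> T"
  obtain a b where "(f has_derivative (\<lambda>(h, k). a * h + b * k)) (at (g t, h t) within S)"
    using f sub[OF t] unfolding holomorphic2_on_def by blast
  then have df: "(f has_derivative (\<lambda>(h, k). a * h + b * k)) (at (g t, h t))"
    using at_within_open[OF sub[OF t] S] by simp
  have dg: "(g has_derivative (*) (deriv g t)) (at t)" and dh: "(h has_derivative (*) (deriv h t)) (at t)"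
    using holomorphic_derivI[OF g T t] holomorphic_derivI[OF h T t]
    by (simp_all add: has_field_derivative_def)
  have "((\<lambda>t. f (g t, h t)) has_derivative
      (\<lambda>x. (\<lambda>(h, k). a * h + b * k) (deriv g t * x, deriv h t * x))) (at t)"
    using has_derivative_compose[OF has_derivative_Pair[OF dg dh] df] .
  then have "((\<lambda>t. f (g t, h t)) has_field_derivative a * deriv g t + b * deriv h t) (at t)"
    unfolding has_field_derivative_def by (rule has_derivative_eq_rhs) (auto simp: algebra_simps)
  then show "\<exists>f'. ((\<lambda>t. f (g t, h t)) has_field_derivative f') (at t)" ..
qed

text \<open>Expanding \<open>q (t, w)\<close> to order 2 in \<open>w\<close> and putting
  \<open>w = t * z\<close> leaves a cubic remainder in \<open>t\<close>. The term of order
  \<open>k\<close> is \<open>o(t^2)\<close>, because the derivatives of \<open>c k\<close> at 0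
  vanish up to order \<open>2 - k\<close>.\<close>

lemma tendsto_slice_divide_square:
  assumes q: "q holomorphic2_on (\<D> \<times> \<D>)"
    and le: "\<And>x y. norm x < 1 \<Longrightarrow> norm y < 1 \<Longrightarrow> norm (q (x, y)) \<le> M"
    and zero: "\<And>I. fst I + snd I \<le> 2 \<Longrightarrow> mixed_partial I q (0, 0) = 0"
    and z: "norm z < 1"
  shows "((\<lambda>t. q (t, t * z) / t ^ 2) \<longlongrightarrow> 0) (at 0)"
proof -
  define c where "c k t = (deriv ^^ k) (\<lambda>w. q (t, w)) 0" for k t
  have hol2: "(\<lambda>w. q (x, w)) holomorphic_on \<D>" if "x \<in> \<D>" for x
    by (rule holomorphic2_on_compose[OF q]) (use that in \<open>auto intro!: open_Times holomorphic_intros\<close>)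
  have hol1: "(\<lambda>x. q (x, w)) holomorphic_on \<D>" if "w \<in> \<D>" for w
    by (rule holomorphic2_on_compose[OF q]) (use that in \<open>auto intro!: open_Times holomorphic_intros\<close>)
  have holc: "c k holomorphic_on \<D>" for k
    unfolding c_def
    by (rule holomorphic_on_Taylor_coeff[where R = 1 and M = M]) (use hol1 hol2 le in auto)
  have c_lim: "((\<lambda>t. c k t / t ^ (2 - k)) \<longlongrightarrow> 0) (at 0)" if "k \<le> 2" for k
  proof (rule tendsto_divide_power_of_higher_derivs_eq_0[OF holc])
    show "(deriv ^^ i) (c k) 0 = 0" if "i \<le> 2 - k" for i
      using zero[of "(i, k)"] that \<open>k \<le> 2\<close> by (simp add: mixed_partial_eq c_def[abs_def])
  qed simp
  define T where "T t = (\<Sum>i\<le>2. c i t * (t * z) ^ i / fact i)" for t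
  define C where "C = fact (Suc 2) * M / (1 / 3) ^ Suc 2 / fact 2"
  have "((\<lambda>t. (q (t, t * z) - T t) / t ^ 2) \<longlongrightarrow> 0) (at 0)"
  proof (rule Lim_null_comparison)
    show "\<forall>\<^sub>F t in at 0. norm ((q (t, t * z) - T t) / t ^ 2) \<le> C * norm z ^ 3 * norm t"
      unfolding eventually_at
    proof (intro exI[of _ "1 / 3"] conjI ballI impI)
      fix t :: complex assume "t \<noteq> 0 \<and> dist t 0 < 1 / 3"
      then have t: "t \<noteq> 0" "norm t < 1 / 3" by auto
      have "norm (t * z) \<le> norm t"
        using z by (simp add: norm_mult mult_left_le)
      then have "norm (q (t, t * z) - T t) \<le> C * norm (t * z) ^ Suc 2"
        unfolding C_def T_def c_def
        by (intro Taylor_remainder_bound hol2 le) (use t in auto)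
      then show "norm ((q (t, t * z) - T t) / t ^ 2) \<le> C * norm z ^ 3 * norm t"
        using t by (simp add: norm_divide norm_power norm_mult field_simps power2_eq_square power3_eq_cube)
    qed simp
    show "((\<lambda>t. C * norm z ^ 3 * norm t) \<longlongrightarrow> 0) (at (0::complex))"
      by (auto intro!: tendsto_eq_intros)
  qed
  moreover have "((\<lambda>t. T t / t ^ 2) \<longlongrightarrow> 0) (at 0)"
  proof (rule Lim_transform_eventually)
    show "((\<lambda>t. \<Sum>i\<le>2. c i t / t ^ (2 - i) * (z ^ i / fact i)) \<longlongrightarrow> 0) (at 0)"
      using c_lim by (intro tendsto_null_sum tendsto_mult_left_zero) auto
    show "\<forall>\<^sub>F t in at 0. (\<Sum>i\<le>2. c i t / t ^ (2 - i) * (z ^ i / fact i)) = T t / t ^ 2"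
      unfolding eventually_at
      by (intro exI[of _ 1]) (auto simp: T_def numeral_2_eq_2 field_simps)
  qed
  ultimately have "((\<lambda>t. (q (t, t * z) - T t) / t ^ 2 + T t / t ^ 2) \<longlongrightarrow> 0 + 0) (at 0)"
    by (rule tendsto_add)
  then show ?thesis by (simp add: diff_divide_distrib)
qed

theorem theorem3p1:
  fixes a10 a01 a20 a11 a02 :: complex
    and p :: "complex \<times> complex \<Rightarrow> complex"
    and p1 p2 :: "complex \<Rightarrow> complex"
  defines "p \<equiv> \<lambda>(z1, z2). a10 * z1 + a01 * z2 + a20 * z1^2 + a11 * z1 * z2 + a02 * z2^2"
    and "p1 \<equiv> \<lambda>z. a10 + a01 * z"
    and "p2 \<equiv> \<lambda>z. a20 + a11 * z + a02 * z^2"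
  assumes "\<exists>q. q holomorphic2_on (\<D> \<times> \<D>) \<and>
    (\<forall>I. fst I + snd I \<le> 2 \<longrightarrow> mixed_partial I q (0, 0) = 0) \<and>
    (SUP z\<in>\<D> \<times> \<D>. ereal (norm (p z + q z))) \<le> 1"
  shows "\<forall>z\<in>\<D>. norm (p1 z)^2 + norm (p2 z) \<le> 1"
proof
  fix z :: complex assume "z \<in> \<D>"
  then have z: "norm z < 1" by simp
  obtain q where q: "q holomorphic2_on (\<D> \<times> \<D>)"
    and zero: "\<And>I. fst I + snd I \<le> 2 \<Longrightarrow> mixed_partial I q (0, 0) = 0"
    and "(SUP z\<in>\<D> \<times> \<D>. ereal (norm (p z + q z))) \<le> 1"
    using assms(4) by blast
  \<comment> \<open>In \<open>ereal\<close> the supremum bounds every value, with no separate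
    boundedness condition.\<close>
  then have pq: "norm (p (x, y) + q (x, y)) \<le> 1" if "norm x < 1" "norm y < 1" for x y
    using that by (auto simp: SUP_le_iff)
  \<comment> \<open>On the bidisc \<open>norm p\<close> is at most the sum of the coefficient norms,
    and the extra 1 bounds \<open>p + q\<close>; the Cauchy estimates for \<open>q\<close> rest on
    this bound.\<close>
  define M where "M = 1 + (norm a10 + norm a01 + norm a20 + norm a11 + norm a02)"
  have q_le: "norm (q (x, y)) \<le> M" if "norm x < 1" "norm y < 1" for x y
  proof -
    have "norm (p (x, y)) \<le> norm a10 + norm a01 + norm a20 + norm a11 + norm a02"
      unfolding p_def prod.case
      by (intro norm_triangle_mono)
         (use that in \<open>auto simp: norm_mult norm_power mult.assoc intro!: mult_left_le mult_le_one power_le_one\<close>)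
    moreover have "norm (q (x, y)) \<le> norm (p (x, y) + q (x, y)) + norm (p (x, y))"
      using norm_triangle_ineq4[of "p (x, y) + q (x, y)" "p (x, y)"] by simp
    ultimately show ?thesis
      using pq[OF that] by (simp add: M_def)
  qed
  have q_lim: "((\<lambda>t. q (t, t * z) / t ^ 2) \<longlongrightarrow> 0) (at 0)"
    using q q_le zero z by (rule tendsto_slice_divide_square)
  have slice: "norm (t * z) < 1" if "norm t < 1" for t
    using norm_mult_less[OF that z] by simp
  have holq: "(\<lambda>t. q (t, t * z)) holomorphic_on \<D>"
    by (rule holomorphic2_on_compose[OF q]) (use slice in \<open>auto intro!: open_Times holomorphic_intros\<close>)
  have q0: "q (0, 0) = 0"
    using zero[of "(0, 0)"] by (simp add: mixed_partial_eq)
  define f where "f t = p (t, t * z) + q (t, t * z)" for t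
  \<comment> \<open>\<open>p1 z\<close> and \<open>p2 z\<close> are the homogeneous parts of
    \<open>p\<close> of degree 1 and 2 at \<open>(1, z)\<close>.\<close>
  have f_eq: "f t = t * p1 z + t ^ 2 * p2 z + q (t, t * z)" for t
    by (simp add: f_def p_def p1_def p2_def power2_eq_square algebra_simps)
  have holf: "f holomorphic_on \<D>"
    unfolding f_eq[abs_def] by (intro holomorphic_intros holq)
  have f_le: "norm (f t) \<le> norm t" if "norm t < 1" for t
    by (rule Schwarz_bound_closed_disc[OF holf])
       (use that slice pq in \<open>auto simp: f_def p_def q0\<close>)
  define g where "g t = (if t = 0 then p1 z else f t / t)" for t
  \<comment> \<open>Differentiability at 0 is read off from the difference quotient first; the
    continuity it implies then makes the singularity of \<open>f t / t\<close> removable.\<close>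
  have dg: "(g has_field_derivative p2 z) (at 0)"
    unfolding has_field_derivative_iff
  proof (rule Lim_transform_eventually)
    show "((\<lambda>t. p2 z + q (t, t * z) / t ^ 2) \<longlongrightarrow> p2 z) (at 0)"
      using tendsto_add[OF tendsto_const q_lim] by simp
    show "\<forall>\<^sub>F t in at 0. p2 z + q (t, t * z) / t ^ 2 = (g t - g 0) / (t - 0)"
      unfolding eventually_at
      by (intro exI[of _ 1]) (auto simp: g_def f_eq field_simps power2_eq_square)
  qed
  have holg: "g holomorphic_on \<D>"
  proof (rule no_isolated_singularity')
    show "(g \<longlongrightarrow> g t) (at t within \<D>)" if "t \<in> {0}" for t
      using DERIV_isCont[OF dg] that by (auto simp: isCont_def intro: tendsto_within_subset)
    show "g holomorphic_on \<D> - {0}"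
    proof (rule holomorphic_transform)
      show "(\<lambda>t. f t / t) holomorphic_on \<D> - {0}"
        by (intro holomorphic_intros holomorphic_on_subset[OF holf]) auto
    qed (simp add: g_def)
  qed auto
  have g_le_punctured: "norm (g t) \<le> 1" if "norm t < 1" "t \<noteq> 0" for t
    using f_le[OF that(1)] that by (simp add: g_def norm_divide divide_simps)
  \<comment> \<open>The Schwarz bound controls the quotient only for \<open>t \<noteq> 0\<close>;
    continuity extends it to 0.\<close>
  moreover have "norm (g 0) \<le> 1"
  proof (rule tendsto_upperbound)
    show "((\<lambda>t. norm (g t)) \<longlongrightarrow> norm (g 0)) (at 0)"
      using DERIV_isCont[OF dg] by (auto simp: isCont_def intro: tendsto_norm)
    show "\<forall>\<^sub>F t in at 0. norm (g t) \<le> 1"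
      unfolding eventually_at by (intro exI[of _ 1]) (auto intro: g_le_punctured)
  qed simp
  ultimately have "norm (g t) \<le> 1" if "norm t < 1" for t
    using that by (cases "t = 0") auto
  then have "norm (g 0) ^ 2 + norm (deriv g 0) \<le> 1"
    by (rule Schwarz_Pick_at_0_closed_disc[OF holg])
  then show "norm (p1 z)^2 + norm (p2 z) \<le> 1"
    by (simp add: DERIV_imp_deriv[OF dg]) (simp add: g_def)
qed

end
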